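(* Let $\mathcal{H}$ be a finite hypothesis class ($|\mathcal{H}|<\infty$), let $T\ge 4$ be an integer and let $0<\delta<1/e$. Then, with probability at least $1-|\mathcal{H}|\,\delta\,\bigl(2+T\log(T/e)\bigr)$, for all $h\in\mathcal{H}$ and all integers $t$ with $4\le t\le T$, $$R(h)\;\ge\;\Bigl[\hat L_t(h)-\frac{2}{t}\log(1/\delta)\,L_{\max}\Bigl(1+\frac{1}{n p_{\min}}\Bigr)-\frac{4}{nt}\sqrt{V_t(h)\log(1/\delta)}-\sqrt{\frac{L_{\max}^2\log(1/\delta)}{2n}}\Bigr]_+ ,$$ where $$V_t(h)=\Bigl[\sum_{i=1}^n\sum_{\tau=1}^t\frac{Q_i^\tau}{(p_i^\tau)^2}L^2(y_ih(x_i))-\Bigl(\sum_{i:\,x_i\in\mathcal{Q}_t}L(y_ih(x_i))\Bigr)^2+\frac{L_{\max}^2\sqrt{2t\log(1/\delta)(n-1)}}{\sqrt{p_{\min}}}\Bigr]_+ .$$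
   Context: Setting (pool-based active learning). $P$ is a probability distribution on $\mathcal{X}\times\{-1,+1\}$, $\mathcal{X}\subset\mathbb{R}^d$, with marginal $P_{\mathcal{X}}$ and conditional label distribution $P_{Y|X=x}$. The pool $\mathcal{P}=\{x_1,\dots,x_n\}$ is sampled i.i.d. from $P_{\mathcal{X}}$; each $x_i$ has a label $y_i\sim P_{Y|X=x_i}$ (so $(x_i,y_i)$ are i.i.d. from $P$). The label is hidden until $x_i$ is first queried; if $x_i$ is queried again, the same label $y_i$ is reused. $\mathcal{H}$ is a class of functions $h:\mathcal{X}\to\mathbb{R}$. The loss $L:\mathbb{R}\to[0,\infty)$ is a convex function of the margin $yh(x)$, with $L(yh(x))\le L_{\max}<\infty$ for all pool points $x\in\mathcal{P}$, labels $y\in\{-1,+1\}$ and $h\in\mathcal{H}$. The risk of $h$ is $R(h)=\mathbb{E}_{(x,y)\sim P}\,L(yh(x))$. Write $L^2(\cdot)=(L(\cdot))^2$ and $[a]_+=\max\{a,0\}$. Querying protocol. In each round $t=1,2,\dots$ a probability vector $p^t=(p_1^t,\dots,p_n^t)$ on the pool is chosen on the basis of the pool and the past observations, with $p_i^t\ge p_{\min}>0$ for all $i$; then exactly one point of the pool is drawn from $p^t$ and queried. $Q_i^t\in\{0,1\}$ is the indicator that $x_i$ is queried in round $t$, so $\sum_i Q_i^t=1$ and $\mathbb{E}[Q_i^t\mid p_i^t]=p_i^t$ (the draw in round $t$ is made from $p^t$ given everything before it). $Z_i^t=y_iQ_i^t$, and $\mathcal{F}_\tau=\sigma(x_{1:n},Z_{1:n}^{1:\tau})$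 is the $\sigma$-algebra generated by $x_1,\dots,x_n$ and all $Z_i^s$ with $1\le i\le n$, $1\le s\le\tau$; $p^t$ is determined by $\mathcal{F}_{t-1}$. Independence assumption: if $x_i$ has not been queried before the start of round $t$, then $p_i^t$ and $y_i$ are conditionally independent given $x_{1:n},Z_{1:n}^{1:t-1}$. Further notation: $\mathcal{Q}_t=\{x_i\in\mathcal{P}:\sum_{\tau=1}^tQ_i^\tau>0\}$ is the set of points queried in the first $t$ rounds, and $\hat L_t(h)=\frac{1}{nt}\sum_{i=1}^n\sum_{\tau=1}^t\frac{Q_i^\tau}{p_i^\tau}L(y_ih(x_i))$. *)

theory Defs
  imports "HOL-Probability.Probability"
begin

definition point_space :: "(real ^ 'd) set \<Rightarrow> (real ^ 'd) measure" where
  "point_space X = restrict_space borel X"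

definition label_space :: "real measure" where
  "label_space = count_space {-1, 1}"

definition example_space :: "(real ^ 'd) set \<Rightarrow> ((real ^ 'd) \<times> real) measure" where
  "example_space X = point_space X \<Otimes>\<^sub>M label_space"

definition risk :: "((real ^ 'd) \<times> real) measure \<Rightarrow> (real \<Rightarrow> real) \<Rightarrow> (real ^ 'd \<Rightarrow> real) \<Rightarrow> real" where
  "risk P L h = (\<integral>z. L (snd z * h (fst z)) \<partial>P)"

definition var_events :: "'w measure \<Rightarrow> 'b measure \<Rightarrow> ('w \<Rightarrow> 'b) \<Rightarrow> 'w set set" where
  "var_events M N U = {U -` A \<inter> space M |A. A \<in> sets N}"

definition history ::
  "'w measure \<Rightarrow> (real ^ 'd) set \<Rightarrow> nat \<Rightarrow> (nat \<Rightarrow> 'w \<Rightarrow> real ^ 'd) \<Rightarrow> (nat \<Rightarrow> nat \<Rightarrow> 'w \<Rightarrow> real)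
    \<Rightarrow> nat \<Rightarrow> 'w measure" where
  "history M X n x Z \<tau> = sigma (space M)
     ((\<Union>i\<in>{1..n}. var_events M (point_space X) (x i)) \<union>
      (\<Union>i\<in>{1..n}. \<Union>s\<in>{1..\<tau>}. var_events M borel (Z i s)))"

text \<open>In contrast to \<^const>\<open>history\<close>, the following \<open>\<sigma>\<close>-algebra also contains all labels, including
  those that have not been revealed yet: it describes everything that precedes the draw of round
  \<open>\<tau> + 1\<close>, not just what the learner has seen.\<close>

definition full_history ::
  "'w measure \<Rightarrow> (real ^ 'd) set \<Rightarrow> nat \<Rightarrow> (nat \<Rightarrow> 'w \<Rightarrow> real ^ 'd) \<Rightarrow> (nat \<Rightarrow> 'w \<Rightarrow> real)
    \<Rightarrow> (nat \<Rightarrow> nat \<Rightarrow> 'w \<Rightarrow> real) \<Rightarrow> nat \<Rightarrow> 'w measure" where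
  "full_history M X n x y Z \<tau> = sigma (space M)
     ((\<Union>i\<in>{1..n}. var_events M (point_space X) (x i)) \<union>
      (\<Union>i\<in>{1..n}. var_events M label_space (y i)) \<union>
      (\<Union>i\<in>{1..n}. \<Union>s\<in>{1..\<tau>}. var_events M borel (Z i s)))"

text \<open>Conditional independence of \<open>U\<close> and \<open>V\<close> given \<open>F\<close>, on the event \<open>E\<close>.\<close>

definition cond_indep_on ::
  "'w measure \<Rightarrow> 'w measure \<Rightarrow> 'w set \<Rightarrow> ('w \<Rightarrow> real) \<Rightarrow> ('w \<Rightarrow> real) \<Rightarrow> bool" where
  "cond_indep_on M F E U V \<longleftrightarrow>
     (\<forall>A\<in>sets borel. \<forall>B\<in>sets borel. AE \<omega> in M. \<omega> \<in> E \<longrightarrow>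
        real_cond_exp M F (\<lambda>\<omega>. indicator A (U \<omega>) * indicator B (V \<omega>)) \<omega> =
        real_cond_exp M F (\<lambda>\<omega>. indicator A (U \<omega>)) \<omega> * real_cond_exp M F (\<lambda>\<omega>. indicator B (V \<omega>)) \<omega>)"

text \<open>
  Hypotheses are total functions on \<open>\<real>\<^sup>d\<close> of which only the values on \<open>X\<close> matter.
  Pool indices and rounds are numbered from 1; \<open>Q i t\<close> and \<open>p i t\<close> belong to pool index \<open>i\<close> and
  round \<open>t\<close>. The loss bound is required almost surely because the pool is random.
\<close>

locale pool_active_learning = prob_space M for M :: "'w measure" +
  fixes X :: "(real ^ 'd) set"
    and P :: "((real ^ 'd) \<times> real) measure"
    and n :: nat
    and x :: "nat \<Rightarrow> 'w \<Rightarrow> real ^ 'd"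
    and y :: "nat \<Rightarrow> 'w \<Rightarrow> real"
    and H :: "(real ^ 'd \<Rightarrow> real) set"
    and L :: "real \<Rightarrow> real"
    and L_max :: real
    and p_min :: real
    and p :: "nat \<Rightarrow> nat \<Rightarrow> 'w \<Rightarrow> real"
    and Q :: "nat \<Rightarrow> nat \<Rightarrow> 'w \<Rightarrow> real"
    and Z :: "nat \<Rightarrow> nat \<Rightarrow> 'w \<Rightarrow> real"
  assumes P_prob: "prob_space P"
    and P_sets: "sets P = sets (example_space X)"
    and n_pos: "1 \<le> n"
    and sample_indep: "indep_vars (\<lambda>_. example_space X) (\<lambda>i \<omega>. (x i \<omega>, y i \<omega>)) {1..n}"
    and sample_distr: "\<And>i. i \<in> {1..n} \<Longrightarrow> distr M (example_space X) (\<lambda>\<omega>. (x i \<omega>, y i \<omega>)) = P"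
    and H_measurable: "\<And>h. h \<in> H \<Longrightarrow> h \<in> borel_measurable (point_space X)"
    and L_convex: "convex_on UNIV L"
    and L_nonneg: "\<And>u. 0 \<le> L u"
    and L_bounded: "AE \<omega> in M. \<forall>i\<in>{1..n}. \<forall>v\<in>{-1, 1}. \<forall>h\<in>H. L (v * h (x i \<omega>)) \<le> L_max"
    and p_min_pos: "0 < p_min"
    and p_lower: "\<And>i t \<omega>. \<lbrakk>i \<in> {1..n}; 1 \<le> t; \<omega> \<in> space M\<rbrakk> \<Longrightarrow> p_min \<le> p i t \<omega>"
    and p_sum: "\<And>t \<omega>. \<lbrakk>1 \<le> t; \<omega> \<in> space M\<rbrakk> \<Longrightarrow> (\<Sum>i=1..n. p i t \<omega>) = 1"
    and Q_measurable: "\<And>i t. \<lbrakk>i \<in> {1..n}; 1 \<le> t\<rbrakk> \<Longrightarrow> Q i t \<in> borel_measurable M"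
    and Q_range: "\<And>i t \<omega>. \<lbrakk>i \<in> {1..n}; 1 \<le> t; \<omega> \<in> space M\<rbrakk> \<Longrightarrow> Q i t \<omega> \<in> {0, 1}"
    and Q_sum: "\<And>t \<omega>. \<lbrakk>1 \<le> t; \<omega> \<in> space M\<rbrakk> \<Longrightarrow> (\<Sum>i=1..n. Q i t \<omega>) = 1"
    and Z_eq: "\<And>i t \<omega>. \<lbrakk>i \<in> {1..n}; 1 \<le> t; \<omega> \<in> space M\<rbrakk> \<Longrightarrow> Z i t \<omega> = y i \<omega> * Q i t \<omega>"
    and p_predictable:
      "\<And>i t. \<lbrakk>i \<in> {1..n}; 1 \<le> t\<rbrakk> \<Longrightarrow> p i t \<in> borel_measurable (history M X n x Z (t - 1))"
    and draw:
      "\<And>i t. \<lbrakk>i \<in> {1..n}; 1 \<le> t\<rbrakk> \<Longrightarrow>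
         AE \<omega> in M. real_cond_exp M (full_history M X n x y Z (t - 1)) (Q i t) \<omega> = p i t \<omega>"
    and label_cond_indep:
      "\<And>i t. \<lbrakk>i \<in> {1..n}; 1 \<le> t\<rbrakk> \<Longrightarrow>
         cond_indep_on M (history M X n x Z (t - 1)) {\<omega> \<in> space M. \<forall>s\<in>{1..<t}. Q i s \<omega> = 0}
           (p i t) (y i)"

definition emp_risk ::
  "nat \<Rightarrow> (nat \<Rightarrow> 'w \<Rightarrow> real ^ 'd) \<Rightarrow> (nat \<Rightarrow> 'w \<Rightarrow> real) \<Rightarrow> (real \<Rightarrow> real)
    \<Rightarrow> (nat \<Rightarrow> nat \<Rightarrow> 'w \<Rightarrow> real) \<Rightarrow> (nat \<Rightarrow> nat \<Rightarrow> 'w \<Rightarrow> real)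
    \<Rightarrow> nat \<Rightarrow> (real ^ 'd \<Rightarrow> real) \<Rightarrow> 'w \<Rightarrow> real" where
  "emp_risk n x y L p Q t h \<omega> =
     1 / (real n * real t) *
       (\<Sum>i=1..n. \<Sum>\<tau>=1..t. Q i \<tau> \<omega> / p i \<tau> \<omega> * L (y i \<omega> * h (x i \<omega>)))"

definition queried ::
  "nat \<Rightarrow> (nat \<Rightarrow> 'w \<Rightarrow> real ^ 'd) \<Rightarrow> (nat \<Rightarrow> nat \<Rightarrow> 'w \<Rightarrow> real) \<Rightarrow> nat \<Rightarrow> 'w \<Rightarrow> (real ^ 'd) set" where
  "queried n x Q t \<omega> = {x i \<omega> |i. i \<in> {1..n} \<and> (\<Sum>\<tau>=1..t. Q i \<tau> \<omega>) > 0}"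

definition emp_var ::
  "nat \<Rightarrow> (nat \<Rightarrow> 'w \<Rightarrow> real ^ 'd) \<Rightarrow> (nat \<Rightarrow> 'w \<Rightarrow> real) \<Rightarrow> (real \<Rightarrow> real) \<Rightarrow> real \<Rightarrow> real
    \<Rightarrow> (nat \<Rightarrow> nat \<Rightarrow> 'w \<Rightarrow> real) \<Rightarrow> (nat \<Rightarrow> nat \<Rightarrow> 'w \<Rightarrow> real)
    \<Rightarrow> real \<Rightarrow> nat \<Rightarrow> (real ^ 'd \<Rightarrow> real) \<Rightarrow> 'w \<Rightarrow> real" where
  "emp_var n x y L L_max p_min p Q \<delta> t h \<omega> =
     max 0
      ((\<Sum>i=1..n. \<Sum>\<tau>=1..t. Q i \<tau> \<omega> / (p i \<tau> \<omega>)\<^sup>2 * (L (y i \<omega> * h (x i \<omega>)))\<^sup>2)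
       - (\<Sum>i\<in>{i\<in>{1..n}. x i \<omega> \<in> queried n x Q t \<omega>}. L (y i \<omega> * h (x i \<omega>)))\<^sup>2
       + L_max\<^sup>2 * sqrt (2 * real t * ln (1 / \<delta>) * (real n - 1)) / sqrt p_min)"

end

theory Submission
  imports Defs
begin

text \<open>
  Fix \<open>h\<close>, let \<open>S\<close> be the total loss over the pool, let \<open>A \<tau>\<close> be the importance weighted loss seen in
  round \<open>\<tau>\<close>, and let \<open>U\<close> be the sum of the \<open>(A \<tau>)\<^sup>2\<close> over the first \<open>t\<close> rounds. Given all labels and
  the past, \<open>A \<tau>\<close> is nonnegative with mean \<open>S\<close>. Since \<open>exp (u - u\<^sup>2 / 2) \<le> 1 + u\<close> for \<open>u \<ge> 0\<close>, the
  process \<open>exp (\<theta> * (\<Sum>\<tau>\<le>t. A \<tau> - S) - \<theta>\<^sup>2 / 2 * U)\<close> is a supermartingale for every \<open>\<theta> > 0\<close>, and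
  Markov's inequality gives a tail bound that is normalized by the observed \<open>U\<close>. Optimizing \<open>\<theta>\<close> over a
  geometric grid of at most \<open>ln (t - 1)\<close> points loses only a constant factor.
  On the event \<open>(\<Sum>\<tau>\<le>t. A \<tau>) > t * S\<close> Cauchy-Schwarz yields \<open>U \<ge> t * S\<^sup>2\<close>, hence
  \<open>U - S\<^sup>2 \<ge> 3 / 4 * U\<close> as \<open>t \<ge> 4\<close>. So the empirical variance may replace \<open>U\<close>, with no need to estimate
  its fluctuations. Hoeffding's inequality relates \<open>S / n\<close> to the risk.
\<close>

section \<open>Self-normalized exponential inequality\<close>

lemma exp_minus_half_square_le:
  fixes u :: real
  assumes "0 \<le> u"
  shows "exp (u - u\<^sup>2 / 2) \<le> 1 + u"
proof -
  have "(\<lambda>u. ln (1 + u) - u + u\<^sup>2 / 2) 0 \<le> (\<lambda>u. ln (1 + u) - u + u\<^sup>2 / 2) u"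
  proof (rule DERIV_nonneg_imp_nondecreasing[OF assms])
    fix v :: real
    assume v: "0 \<le> v" "v \<le> u"
    have "((\<lambda>u. ln (1 + u) - u + u\<^sup>2 / 2) has_real_derivative 1 / (1 + v) - 1 + v) (at v)"
      using v by (auto intro!: derivative_eq_intros)
    moreover have "1 / (1 + v) - 1 + v = v\<^sup>2 / (1 + v)"
      using v by (simp add: field_simps power2_eq_square)
    ultimately show "\<exists>d. ((\<lambda>u. ln (1 + u) - u + u\<^sup>2 / 2) has_real_derivative d) (at v) \<and> 0 \<le> d"
      using v by (intro exI[of _ "v\<^sup>2 / (1 + v)"]) simp
  qed
  then have "u - u\<^sup>2 / 2 \<le> ln (1 + u)"
    by simp
  then show ?thesis
    using assms by (simp add: ln_ge_iff)
qed

text \<open>Each round multiplies the process by at most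
  \<open>exp (- \<theta> * S) * (1 + \<theta> * A)\<close>, whose conditional mean is
  \<open>exp (- \<theta> * S) * (1 + \<theta> * S)\<close>, hence at most 1. The mean
  \<open>S\<close> may be random, as long as it is known before the first round.\<close>

lemma (in prob_space) self_normalized_exp_integral:
  fixes G :: "nat \<Rightarrow> 'a measure" and A :: "nat \<Rightarrow> 'a \<Rightarrow> real"
  assumes G_M: "\<And>k. subalgebra M (G k)"
    and G_mono: "\<And>k. subalgebra (G (Suc k)) (G k)"
    and A_meas: "\<And>k. A (Suc k) \<in> borel_measurable (G (Suc k))"
    and S_meas: "\<And>k. S \<in> borel_measurable (G k)"
    and A_nonneg: "\<And>k \<omega>. \<omega> \<in> space M \<Longrightarrow> 0 \<le> A (Suc k) \<omega>"
    and S_nonneg: "\<And>\<omega>. \<omega> \<in> space M \<Longrightarrow> 0 \<le> S \<omega>"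
    and A_int: "\<And>k. integrable M (A (Suc k))"
    and A_cond: "\<And>k. AE \<omega> in M. real_cond_exp M (G k) (A (Suc k)) \<omega> = S \<omega>"
    and "0 \<le> \<theta>"
  defines "K \<equiv> \<lambda>t \<omega>. exp (\<theta> * (\<Sum>k=1..t. A k \<omega> - S \<omega>) - \<theta>\<^sup>2 / 2 * (\<Sum>k=1..t. (A k \<omega>)\<^sup>2))"
  shows "integrable M (K t)" and "expectation (K t) \<le> 1"
proof -
  \<comment> \<open>The last factor is the one that \<open>exp_minus_half_square_le\<close> bounds,
    with \<open>u = \<theta> * A (Suc k) \<omega>\<close>; the other two are already
    \<open>G k\<close>-measurable.\<close>
  have one_step: "K (Suc k) \<omega> = K k \<omega> * exp (- \<theta> * S \<omega>) *
      exp (\<theta> * A (Suc k) \<omega> - (\<theta> * A (Suc k) \<omega>)\<^sup>2 / 2)" for k \<omega>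
    unfolding K_def mult_exp_exp by (simp add: algebra_simps power_mult_distrib)
  have K_G: "K k \<in> borel_measurable (G k)" for k
  proof (induction k)
    case 0
    then show ?case by (simp add: K_def)
  next
    case (Suc k)
    have "K k \<in> borel_measurable (G (Suc k))"
      by (rule measurable_from_subalg[OF G_mono Suc])
    with A_meas[of k] S_meas[of "Suc k"] show ?case
      unfolding one_step by measurable
  qed
  have K_M: "K k \<in> borel_measurable M" for k
    by (rule measurable_from_subalg[OF G_M K_G])
  have S_M: "S \<in> borel_measurable M"
    by (rule measurable_from_subalg[OF G_M S_meas])
  have K_pos: "0 < K k \<omega>" for k \<omega>
    by (simp add: K_def)
  have "K t \<in> borel_measurable M \<and> integrable M (K t) \<and> expectation (K t) \<le> 1"
  proof (induction t)
    case 0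
    then show ?case by (simp add: K_def prob_space)
  next
    case (Suc k)
    define W where "W \<omega> = K k \<omega> * exp (- \<theta> * S \<omega>)" for \<omega>
    have W_G: "W \<in> borel_measurable (G k)"
      unfolding W_def using K_G[of k] S_meas[of k] by measurable
    have W_M: "W \<in> borel_measurable M"
      by (rule measurable_from_subalg[OF G_M W_G])
    have W_pos: "0 < W \<omega>" for \<omega>
      using K_pos by (simp add: W_def)
    have K_int: "integrable M (K k)" 
      using Suc by blast
    \<comment> \<open>Completing the square bounds every exponent increment by 1/2, so
      \<open>K k\<close> is bounded even if \<open>A\<close> is not. Together with integrability of
      \<open>A\<close> this makes \<open>W * A\<close> integrable.\<close>
    have K_bound: "K k \<omega> \<le> exp (real k / 2)" if "\<omega> \<in> space M" for \<omega>
    proof -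
      have "\<theta> * (\<Sum>j=1..k. A j \<omega> - S \<omega>) - \<theta>\<^sup>2 / 2 * (\<Sum>j=1..k. (A j \<omega>)\<^sup>2)
          = (\<Sum>j=1..k. \<theta> * A j \<omega> - (\<theta> * A j \<omega>)\<^sup>2 / 2 - \<theta> * S \<omega>)"
        by (simp add: sum_distrib_left sum_subtractf sum.distrib algebra_simps power_mult_distrib)
      also have "\<dots> \<le> (\<Sum>j=1..k. 1 / 2)"
      proof (rule sum_mono)
        fix j
        have "0 \<le> (\<theta> * A j \<omega> - 1)\<^sup>2" and "0 \<le> \<theta> * S \<omega>"
          using S_nonneg[OF that] \<open>0 \<le> \<theta>\<close> by auto
        then show "\<theta> * A j \<omega> - (\<theta> * A j \<omega>)\<^sup>2 / 2 - \<theta> * S \<omega> \<le> 1 / 2"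
          by (simp add: power2_eq_square algebra_simps)
      qed
      finally show ?thesis by (simp add: K_def)
    qed
    have W_le: "W \<omega> \<le> K k \<omega>" if "\<omega> \<in> space M" for \<omega>
      using K_pos[of k \<omega>] S_nonneg[OF that] \<open>0 \<le> \<theta>\<close>
      by (simp add: W_def mult_left_le)
    have WA_int: "integrable M (\<lambda>\<omega>. W \<omega> * A (Suc k) \<omega>)"
    proof (rule Bochner_Integration.integrable_bound[OF integrable_mult_right[OF A_int[of k], of "exp (real k / 2)"]])
      show "(\<lambda>\<omega>. W \<omega> * A (Suc k) \<omega>) \<in> borel_measurable M"
        using W_M A_int by measurable
      show "AE \<omega> in M. norm (W \<omega> * A (Suc k) \<omega>) \<le> norm (exp (real k / 2) * A (Suc k) \<omega>)"
      proof (rule AE_I2)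
        fix \<omega> assume "\<omega> \<in> space M"
        then have "W \<omega> \<le> exp (real k / 2)" and "0 \<le> A (Suc k) \<omega>"
          using K_bound W_le A_nonneg by force+
        then show "norm (W \<omega> * A (Suc k) \<omega>) \<le> norm (exp (real k / 2) * A (Suc k) \<omega>)"
          using W_pos[of \<omega>] by (simp add: abs_mult mult_right_mono)
      qed
    qed
    have W_int: "integrable M W"
    proof (rule Bochner_Integration.integrable_bound[OF K_int W_M], rule AE_I2)
      fix \<omega> assume "\<omega> \<in> space M"
      from W_le[OF this] W_pos[of \<omega>] show "norm (W \<omega>) \<le> norm (K k \<omega>)"
        by simp
    qed
    interpret sub: finite_measure_subalgebra M "G k"
      by unfold_locales (rule G_M)
    \<comment> \<open>Since \<open>W\<close> is \<open>G k\<close>-measurable, the conditional mean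
      \<open>S\<close> may replace \<open>A (Suc k)\<close> under the integral.\<close>
    have WA_eq: "(\<integral>\<omega>. W \<omega> * A (Suc k) \<omega> \<partial>M) = (\<integral>\<omega>. W \<omega> * S \<omega> \<partial>M)"
    proof -
      have "(\<integral>\<omega>. W \<omega> * A (Suc k) \<omega> \<partial>M) = (\<integral>\<omega>. W \<omega> * real_cond_exp M (G k) (A (Suc k)) \<omega> \<partial>M)"
        using sub.real_cond_exp_intg(2)[OF WA_int W_G] A_int by simp
      also have "\<dots> = (\<integral>\<omega>. W \<omega> * S \<omega> \<partial>M)"
      proof (rule integral_cong_AE)
        show "AE \<omega> in M. W \<omega> * real_cond_exp M (G k) (A (Suc k)) \<omega> = W \<omega> * S \<omega>"
          using A_cond[of k] by eventually_elim simp
      qed (use W_M S_M in \<open>measurable\<close>)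
      finally show ?thesis .
    qed
    have WS_int: "integrable M (\<lambda>\<omega>. W \<omega> * S \<omega>)"
    proof -
      have "integrable M (\<lambda>\<omega>. W \<omega> * real_cond_exp M (G k) (A (Suc k)) \<omega>)"
        using sub.real_cond_exp_intg(1)[OF WA_int W_G] A_int by simp
      then show ?thesis
      proof (rule integrable_cong_AE_imp)
        show "AE \<omega> in M. W \<omega> * real_cond_exp M (G k) (A (Suc k)) \<omega> = W \<omega> * S \<omega>"
          using A_cond[of k] by eventually_elim simp
      qed (use W_M S_M in \<open>measurable\<close>)
    qed
    have K_Suc_le: "K (Suc k) \<omega> \<le> W \<omega> + \<theta> * (W \<omega> * A (Suc k) \<omega>)" if "\<omega> \<in> space M" for \<omega>
    proof -
      have "K (Suc k) \<omega> \<le> W \<omega> * (1 + \<theta> * A (Suc k) \<omega>)"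
        unfolding one_step W_def[symmetric]
        using W_pos[of \<omega>] A_nonneg[OF that] \<open>0 \<le> \<theta>\<close>
        by (intro mult_left_mono exp_minus_half_square_le) auto
      then show ?thesis by (simp add: algebra_simps)
    qed
    have rhs_int: "integrable M (\<lambda>\<omega>. W \<omega> + \<theta> * (W \<omega> * A (Suc k) \<omega>))"
      using W_int WA_int by auto
    have K_Suc_int: "integrable M (K (Suc k))"
    proof (rule Bochner_Integration.integrable_bound[OF rhs_int K_M], rule AE_I2)
      fix \<omega> assume "\<omega> \<in> space M"
      from K_Suc_le[OF this] K_pos[of "Suc k" \<omega>]
      show "norm (K (Suc k) \<omega>) \<le> norm (W \<omega> + \<theta> * (W \<omega> * A (Suc k) \<omega>))"
        by simp
    qed
    have "expectation (K (Suc k)) \<le> (\<integral>\<omega>. W \<omega> + \<theta> * (W \<omega> * A (Suc k) \<omega>) \<partial>M)"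
      by (intro integral_mono K_Suc_int rhs_int K_Suc_le)
    also have "\<dots> = (\<integral>\<omega>. W \<omega> + \<theta> * (W \<omega> * S \<omega>) \<partial>M)"
      using W_int WA_int WS_int WA_eq by simp
    \<comment> \<open>The factor \<open>exp (- \<theta> * S)\<close> inside \<open>W\<close> absorbs
      \<open>1 + \<theta> * S\<close>.\<close>
    also have "\<dots> \<le> expectation (K k)"
    proof (rule integral_mono)
      show "integrable M (\<lambda>\<omega>. W \<omega> + \<theta> * (W \<omega> * S \<omega>))"
        using W_int WS_int by auto
      fix \<omega> assume "\<omega> \<in> space M"
      have "W \<omega> + \<theta> * (W \<omega> * S \<omega>) = W \<omega> * (1 + \<theta> * S \<omega>)"
        by (simp add: algebra_simps)
      also have "\<dots> \<le> W \<omega> * exp (\<theta> * S \<omega>)"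
        using W_pos[of \<omega>] by (intro mult_left_mono exp_ge_add_one_self) auto
      also have "\<dots> = K k \<omega>"
        by (simp add: W_def mult_exp_exp mult.assoc)
      finally show "W \<omega> + \<theta> * (W \<omega> * S \<omega>) \<le> K k \<omega>" .
    qed (fact K_int)
    finally show ?case
      using K_Suc_int K_M Suc by auto
  qed
  then show "integrable M (K t)" and "expectation (K t) \<le> 1"
    by blast+
qed

text \<open>After multiplication by \<open>\<theta> > 0\<close> the event says that the exponential
  process is at least \<open>exp c\<close>, so Markov's inequality applies.\<close>

lemma (in prob_space) self_normalized_tail:
  fixes G :: "nat \<Rightarrow> 'a measure" and A :: "nat \<Rightarrow> 'a \<Rightarrow> real"
  assumes G_M: "\<And>k. subalgebra M (G k)"
    and G_mono: "\<And>k. subalgebra (G (Suc k)) (G k)"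
    and A_meas: "\<And>k. A (Suc k) \<in> borel_measurable (G (Suc k))"
    and S_meas: "\<And>k. S \<in> borel_measurable (G k)"
    and A_nonneg: "\<And>k \<omega>. \<omega> \<in> space M \<Longrightarrow> 0 \<le> A (Suc k) \<omega>"
    and S_nonneg: "\<And>\<omega>. \<omega> \<in> space M \<Longrightarrow> 0 \<le> S \<omega>"
    and A_int: "\<And>k. integrable M (A (Suc k))"
    and A_cond: "\<And>k. AE \<omega> in M. real_cond_exp M (G k) (A (Suc k)) \<omega> = S \<omega>"
    and "0 < \<theta>"
  shows "prob {\<omega>\<in>space M. c / \<theta> + \<theta> / 2 * (\<Sum>k=1..t. (A k \<omega>)\<^sup>2) \<le> (\<Sum>k=1..t. A k \<omega> - S \<omega>)} \<le> exp (- c)"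
    (is "prob ?E \<le> _")
proof -
  define K where "K \<omega> = exp (\<theta> * (\<Sum>k=1..t. A k \<omega> - S \<omega>) - \<theta>\<^sup>2 / 2 * (\<Sum>k=1..t. (A k \<omega>)\<^sup>2))" for \<omega>
  have K_pos: "0 < K \<omega>" for \<omega>
    by (simp add: K_def)
  have K: "integrable M K" "expectation K \<le> 1"
    unfolding K_def[abs_def]
    by (rule self_normalized_exp_integral[where G = G]; (fact assms less_imp_le[OF \<open>0 < \<theta>\<close>])?)+
  have "?E = {\<omega>\<in>space M. exp c \<le> K \<omega>}"
    using \<open>0 < \<theta>\<close> by (auto simp: K_def field_simps power2_eq_square)
  moreover have "prob {\<omega>\<in>space M. exp c \<le> K \<omega>} \<le> expectation K / exp c"
    by (rule integral_Markov_inequality_measure[where A = "space M"]) (use K(1) K_pos in \<open>auto simp: less_imp_le\<close>)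
  moreover have "expectation K / exp c \<le> exp (- c)"
    using K(2) by (simp add: exp_minus field_simps)
  ultimately show ?thesis by simp
qed

section \<open>The parameter grid and its size\<close>

text \<open>Bounds the total number of grid points over all rounds. In the induction step
  \<open>T * ln (T / e)\<close> grows by at least \<open>ln T\<close>, because
  \<open>ln (T + 1) - ln T\<close> is at least \<open>1 / (T + 1)\<close>.\<close>

lemma sum_ln_le:
  assumes "4 \<le> T"
  shows "(\<Sum>t=4..T. ln (real t - 1)) \<le> 1 + real T * ln (real T / exp 1)"
  using assms
proof (induction T rule: dec_induct)
  case base
  have "exp 1 \<le> (4::real)" using exp_le by simp
  have "ln (4::real) \<ge> 1" using \<open>exp 1 \<le> (4::real)\<close> by (simp add: ln_ge_iff)
  have "ln (3::real) \<le> 4 * ln 4 - 3"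
  proof -
    have "ln (3::real) \<le> ln 4" by simp
    then show ?thesis using \<open>ln (4::real) \<ge> 1\<close> by linarith
  qed
  then show ?case by (simp add: ln_div)
next
  case (step T)
  have T: "0 < real T" using step by simp
  have "ln (real (Suc T)) \<ge> ln (real T) + 1 / real (Suc T)"
  proof -
    have "ln (real T / real (Suc T)) \<le> real T / real (Suc T) - 1"
      using T by (intro ln_le_minus_one) auto
    moreover have "real T / real (Suc T) - 1 = - 1 / real (Suc T)"
      by (simp add: field_simps)
    ultimately show ?thesis using T by (simp add: ln_div)
  qed
  then have "real (Suc T) * (ln (real T) + 1 / real (Suc T)) \<le> real (Suc T) * ln (real (Suc T))"
    by (intro mult_left_mono) auto
  then have "ln (real T) + real T * ln (real T / exp 1) \<le> real (Suc T) * ln (real (Suc T) / exp 1)"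
    using T by (simp add: ln_div algebra_simps)
  moreover have "(\<Sum>t=4..Suc T. ln (real t - 1)) = (\<Sum>t=4..T. ln (real t - 1)) + ln (real T)"
    using step by simp
  ultimately show ?case using step by linarith
qed

text \<open>In normalized form, \<open>j\<close> balances the two terms of the tail bound. Over real
  \<open>j\<close> their minimum would be \<open>sqrt 2 * w\<close>, at
  \<open>exp j = w / (2 * sqrt 2)\<close>; the constant 3.2 pays for integrality and for keeping
  \<open>j\<close> inside the index range.\<close>

lemma geometric_grid:
  fixes w :: real
  assumes "4 \<le> t" "0 \<le> w" "w\<^sup>2 \<le> real t"
  shows "\<exists>j < nat \<lfloor>ln (real t - 1)\<rfloor>. 2 * exp (real j) + exp (- real j) * w\<^sup>2 / 4 \<le> 2 + 3.2 * w"
proof (cases "w \<le> 10")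
  case True
  \<comment> \<open>As \<open>e \<le> 3\<close>, the assumption \<open>t \<ge> 4\<close> ensures
    that the grid contains \<open>j = 0\<close>, which serves all \<open>w \<le> 10\<close>.\<close>
  have "exp 1 \<le> real t - 1"
    using exp_le assms by linarith
  then have "1 \<le> ln (real t - 1)"
    by (subst ln_ge_iff) (use assms in auto)
  then have "0 < nat \<lfloor>ln (real t - 1)\<rfloor>" by linarith
  moreover have "w\<^sup>2 / 4 \<le> 3.2 * w"
    using True assms(2) mult_right_mono[OF True assms(2)] by (simp add: power2_eq_square)
  ultimately show ?thesis by (intro exI[of _ 0]) auto
next
  case False
  \<comment> \<open>Aiming at \<open>w / 10\<close>, below the optimum, puts \<open>exp j\<close>
    between \<open>w / 10\<close> and \<open>3 * w / 10\<close>, so the two terms are at most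
    \<open>0.6 * w\<close> and \<open>2.5 * w\<close>. The gain is in the index:
    \<open>ln 10 \<ge> 2\<close> compensates both for the ceiling and for the strict bound on
    \<open>j\<close>.\<close>
  define j where "j = nat \<lceil>ln (w / 10)\<rceil>"
  have ln_nonneg: "0 \<le> ln (w / 10)" using False by simp
  then have j: "ln (w / 10) \<le> real j" "real j < ln (w / 10) + 1"
    unfolding j_def by linarith+
  have ej: "w / 10 \<le> exp (real j)"
    using exp_mono[OF j(1)] False by simp
  have "exp (real j) \<le> exp (ln (w / 10) + 1)" using j by simp
  also have "\<dots> = w / 10 * exp 1" using False by (simp add: exp_add)
  also have "\<dots> \<le> w / 10 * 3" using exp_le False by (intro mult_left_mono) auto
  finally have *: "2 * exp (real j) \<le> 0.6 * w" using False by simp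
  have "exp (- real j) * w \<le> 10"
    using ej by (simp add: exp_minus field_simps)
  then have "exp (- real j) * w * w \<le> 10 * w"
    using False by (intro mult_right_mono) auto
  then have "exp (- real j) * w\<^sup>2 / 4 \<le> 2.5 * w" by (simp add: power2_eq_square algebra_simps)
  with * False have "2 * exp (real j) + exp (- real j) * w\<^sup>2 / 4 \<le> 2 + 3.2 * w" by simp
  moreover have "j < nat \<lfloor>ln (real t - 1)\<rfloor>"
  proof -
    have "exp 2 \<le> (10::real)"
    proof -
      have "exp 2 = exp 1 * exp (1::real)" by (simp add: mult_exp_exp)
      also have "\<dots> \<le> 3 * 3" using exp_le by (intro mult_mono) auto
      finally show ?thesis by simp
    qed
    then have "2 \<le> ln (10::real)" by (simp add: ln_ge_iff)
    have "w \<le> real t - 1"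
    proof (rule power2_le_imp_le)
      have "real t \<le> (real t - 1)\<^sup>2"
        using mult_mono[of 3 "real t - 1" "real t - 1" "real t - 1"] assms(1) by (simp add: power2_eq_square)
      then show "w\<^sup>2 \<le> (real t - 1)\<^sup>2" using assms(3) by linarith
    qed (use assms in auto)
    then have "ln w \<le> ln (real t - 1)" using False by simp
    then have "real j + 1 \<le> ln (real t - 1)"
      using j(2) \<open>2 \<le> ln 10\<close> False by (simp add: ln_div)
    then show ?thesis by linarith
  qed
  ultimately show ?thesis by blast
qed

text \<open>
  The optimal parameter for given \<open>U\<close> is \<open>sqrt (2 * c / U)\<close>; for small \<open>U\<close> the additive term
  \<open>2 * c * b\<close> already covers the largest grid point \<open>1 / (2 * B)\<close>.
\<close>

lemma deviation_le_of_grid: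
  fixes a S V B b c U :: real
  assumes t: "4 \<le> t" and c: "1 \<le> c" and B: "0 < B" "B \<le> b"
    and S: "0 \<le> S" and a_sq: "a\<^sup>2 \<le> real t * U" and U: "0 \<le> U" "U \<le> real t * B\<^sup>2"
    and V: "U - S\<^sup>2 \<le> V"
    and grid: "\<And>j. j < nat \<lfloor>ln (real t - 1)\<rfloor> \<Longrightarrow>
      a - real t * S < c / (exp (- real j) / (2 * B)) + exp (- real j) / (2 * B) / 2 * U"
  shows "a - real t * S \<le> 2 * c * b + 4 * sqrt (max 0 V * c)"
proof (cases "a \<le> real t * S")
  case True
  have "0 \<le> 2 * c * b" and "0 \<le> 4 * sqrt (max 0 V * c)"
    using c B by auto
  with True show ?thesis by linarith
next
  case False
  \<comment> \<open>With this scaling and \<open>\<theta> = exp (- j) / (2 * B)\<close>, both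
    \<open>c / \<theta>\<close> and \<open>\<theta> / 2 * U\<close> become multiples of
    \<open>c * B\<close>, as in \<open>geometric_grid\<close>.\<close>
  define w where "w = sqrt (U / (B\<^sup>2 * c))"
  have w2: "w\<^sup>2 = U / (B\<^sup>2 * c)" using U c by (simp add: w_def)
  have U_eq: "U = w\<^sup>2 * (B\<^sup>2 * c)" using B c by (simp add: w2)
  \<comment> \<open>Here \<open>c \<ge> 1\<close> is used: it keeps \<open>w^2\<close> within the
    range \<open>t\<close> that the grid covers.\<close>
  have "U / (B\<^sup>2 * c) \<le> U / B\<^sup>2"
    using U c B by (intro divide_left_mono) (auto simp: mult_le_cancel_left1)
  also have "\<dots> \<le> real t" using U B by (simp add: divide_le_eq)
  finally have "w\<^sup>2 \<le> real t" by (simp add: w2)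
  moreover have "0 \<le> w" using U c by (simp add: w_def)
  ultimately obtain j where j: "j < nat \<lfloor>ln (real t - 1)\<rfloor>"
    and "2 * exp (real j) + exp (- real j) * w\<^sup>2 / 4 \<le> 2 + 3.2 * w"
    using geometric_grid[OF t] by blast
  then have le: "(c * B) * (2 * exp (real j) + exp (- real j) * w\<^sup>2 / 4) \<le> (c * B) * (2 + 3.2 * w)"
    using c B by (intro mult_left_mono) auto
  have "c / (exp (- real j) / (2 * B)) + exp (- real j) / (2 * B) / 2 * U
      = (c * B) * (2 * exp (real j) + exp (- real j) * w\<^sup>2 / 4)"
    using c B by (simp add: U_eq exp_minus field_simps power2_eq_square)
  with grid[OF j] le have "a - real t * S \<le> 2 * c * B + 3.2 * (c * B * w)"
    by (simp add: algebra_simps)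
  moreover have "2 * c * B \<le> 2 * c * b"
    using B c by (intro mult_left_mono) auto
  moreover have "3.2 * (c * B * w) \<le> 4 * sqrt (max 0 V * c)"
  proof -
    have "(real t * S)\<^sup>2 \<le> a\<^sup>2"
      using False S by (intro power_mono) auto
    with a_sq have "real t * (real t * S\<^sup>2) \<le> real t * U"
      by (simp add: power2_eq_square mult_ac)
    then have "real t * S\<^sup>2 \<le> U" using t by simp
    moreover have "4 * S\<^sup>2 \<le> real t * S\<^sup>2" using t by (intro mult_right_mono) auto
    ultimately have "3 / 4 * U \<le> max 0 V" using V by linarith
    then have "3 / 4 * U * c \<le> max 0 V * c" using c by (intro mult_right_mono) auto
    moreover have "(c * B * w)\<^sup>2 = U * c"
      by (simp add: U_eq power_mult_distrib power2_eq_square)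
    moreover have "0 \<le> U * c" using U c by simp
    \<comment> \<open>The grid constant fits because \<open>(3.2 / 4)^2 = 16/25\<close> is below the
      fraction 3/4 of \<open>U\<close> that \<open>V\<close> retains.\<close>
    moreover have "(3.2 / 4 * (c * B * w))\<^sup>2 = 16 / 25 * (c * B * w)\<^sup>2"
      by (simp add: power2_eq_square)
    ultimately have "(3.2 / 4 * (c * B * w))\<^sup>2 \<le> max 0 V * c"
      by linarith
    then have "3.2 / 4 * (c * B * w) \<le> sqrt (max 0 V * c)"
      by (rule real_le_rsqrt)
    then show ?thesis by linarith
  qed
  ultimately show ?thesis by linarith
qed

section \<open>Pool losses and the filtration of the querying process\<close>

context pool_active_learning
begin

definition loss :: "(real ^ 'd \<Rightarrow> real) \<Rightarrow> nat \<Rightarrow> 'w \<Rightarrow> real" where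
  "loss h i \<omega> = L (y i \<omega> * h (x i \<omega>))"

text \<open>In the general tail bound, \<open>total_loss h\<close> takes the place of
  \<open>S\<close> and \<open>round_loss h\<close> that of \<open>A\<close>.\<close>

definition total_loss :: "(real ^ 'd \<Rightarrow> real) \<Rightarrow> 'w \<Rightarrow> real" where
  "total_loss h \<omega> = (\<Sum>i=1..n. loss h i \<omega>)"

definition round_loss :: "(real ^ 'd \<Rightarrow> real) \<Rightarrow> nat \<Rightarrow> 'w \<Rightarrow> real" where
  "round_loss h \<tau> \<omega> = (\<Sum>i=1..n. Q i \<tau> \<omega> / p i \<tau> \<omega> * loss h i \<omega>)"

text \<open>The total loss involves labels that may never be revealed. Conditioning on all labels
  makes it measurable from time 0 on, and \<open>draw\<close> gives the query probabilities relative
  to this larger \<sigma>-algebra.\<close>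

abbreviation "G \<equiv> full_history M X n x y Z"

lemma L_borel: "L \<in> borel_measurable borel"
proof -
  have "continuous_on UNIV L"
    by (rule convex_on_continuous) (use L_convex in auto)
  then show ?thesis by (rule borel_measurable_continuous_onI)
qed

lemma label_space_borel: "label_space \<rightarrow>\<^sub>M borel = {-1, 1} \<rightarrow> UNIV"
  by (auto simp: label_space_def measurable_count_space_eq1)

lemma loss_example_measurable:
  assumes "h \<in> H"
  shows "(\<lambda>z. L (snd z * h (fst z))) \<in> borel_measurable (example_space X)"
proof -
  have "(\<lambda>v. v) \<in> label_space \<rightarrow>\<^sub>M (borel :: real measure)"
    by (simp add: label_space_borel)
  then have "snd \<in> example_space X \<rightarrow>\<^sub>M (borel :: real measure)"
    unfolding example_space_def by (rule measurable_compose[OF measurable_snd])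
  moreover have "(\<lambda>z. h (fst z)) \<in> borel_measurable (example_space X)"
    unfolding example_space_def by (rule measurable_compose[OF measurable_fst H_measurable[OF assms]])
  ultimately show ?thesis
    using L_borel by measurable
qed

lemma example_measurable:
  assumes "i \<in> {1..n}"
  shows "(\<lambda>\<omega>. (x i \<omega>, y i \<omega>)) \<in> M \<rightarrow>\<^sub>M example_space X"
  using sample_indep assms unfolding indep_vars_def by blast

lemma x_measurable:
  assumes "i \<in> {1..n}"
  shows "x i \<in> M \<rightarrow>\<^sub>M point_space X"
  using measurable_compose[OF example_measurable[OF assms, unfolded example_space_def] measurable_fst]
  by simp

lemma y_measurable:
  assumes "i \<in> {1..n}"
  shows "y i \<in> M \<rightarrow>\<^sub>M label_space"
  using measurable_compose[OF example_measurable[OF assms, unfolded example_space_def] measurable_snd]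
  by simp

lemma y_range:
  assumes "i \<in> {1..n}" "\<omega> \<in> space M"
  shows "y i \<omega> \<in> {-1, 1}"
  using measurable_space[OF y_measurable[OF assms(1)] assms(2)] by (simp add: label_space_def)

lemma Z_measurable:
  assumes "i \<in> {1..n}" "1 \<le> s"
  shows "Z i s \<in> borel_measurable M"
proof -
  have "y i \<in> borel_measurable M"
    by (rule measurable_compose[OF y_measurable[OF assms(1)], of "\<lambda>v. v", simplified])
      (simp add: label_space_borel)
  then have "(\<lambda>\<omega>. y i \<omega> * Q i s \<omega>) \<in> borel_measurable M"
    using Q_measurable[OF assms] by measurable
  then show ?thesis
    using Z_eq[OF assms] by (simp cong: measurable_cong)
qed

lemma var_events_sets: "U \<in> M \<rightarrow>\<^sub>M N \<Longrightarrow> var_events M N U \<subseteq> sets M"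
  by (auto simp: var_events_def)

lemma history_gen_subset:
  "(\<Union>i\<in>{1..n}. var_events M (point_space X) (x i)) \<union>
   (\<Union>i\<in>{1..n}. var_events M label_space (y i)) \<union>
   (\<Union>i\<in>{1..n}. \<Union>s\<in>{1..\<tau>}. var_events M borel (Z i s)) \<subseteq> sets M"
  by (intro Un_least UN_least var_events_sets x_measurable y_measurable Z_measurable) auto

lemma space_G: "space (G \<tau>) = space M"
  by (simp add: full_history_def space_measure_of_conv)

lemma sets_G: "sets (G \<tau>) = sigma_sets (space M)
  ((\<Union>i\<in>{1..n}. var_events M (point_space X) (x i)) \<union>
   (\<Union>i\<in>{1..n}. var_events M label_space (y i)) \<union>
   (\<Union>i\<in>{1..n}. \<Union>s\<in>{1..\<tau>}. var_events M borel (Z i s)))"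
  unfolding full_history_def
  by (rule sets_measure_of) (use history_gen_subset[of \<tau>] sets.space_closed in blast)

lemma G_subalgebra: "subalgebra M (G \<tau>)"
  unfolding subalgebra_def space_G sets_G
  using sets.sigma_sets_subset[OF history_gen_subset] by simp

lemma G_mono:
  assumes "\<sigma> \<le> \<tau>"
  shows "subalgebra (G \<tau>) (G \<sigma>)"
  unfolding subalgebra_def space_G sets_G
  using assms by (intro conjI refl sigma_sets_mono') fastforce

lemma G_history: "subalgebra (G \<tau>) (history M X n x Z \<tau>)"
proof -
  have "sets (history M X n x Z \<tau>) = sigma_sets (space M)
    ((\<Union>i\<in>{1..n}. var_events M (point_space X) (x i)) \<union>
     (\<Union>i\<in>{1..n}. \<Union>s\<in>{1..\<tau>}. var_events M borel (Z i s)))"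
    unfolding history_def
    by (rule sets_measure_of) (use history_gen_subset[of \<tau>] sets.space_closed in blast)
  then show ?thesis
    unfolding subalgebra_def space_G sets_G
    by (auto simp: history_def space_measure_of_conv intro!: sigma_sets_mono')
qed

lemma var_events_measurable:
  assumes U: "U \<in> M \<rightarrow>\<^sub>M N" and "var_events M N U \<subseteq> sets (G \<tau>)"
  shows "U \<in> G \<tau> \<rightarrow>\<^sub>M N"
  using assms measurable_space[OF U] unfolding var_events_def
  by (intro measurableI) (auto simp: space_G)

lemma x_G: "i \<in> {1..n} \<Longrightarrow> x i \<in> G \<tau> \<rightarrow>\<^sub>M point_space X"
  by (rule var_events_measurable[OF x_measurable]) (auto simp: sets_G intro!: sigma_sets.Basic)

lemma y_G: "i \<in> {1..n} \<Longrightarrow> y i \<in> G \<tau> \<rightarrow>\<^sub>M label_space"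
  by (rule var_events_measurable[OF y_measurable]) (auto simp: sets_G intro!: sigma_sets.Basic)

lemma Z_G: "i \<in> {1..n} \<Longrightarrow> s \<in> {1..\<tau>} \<Longrightarrow> Z i s \<in> borel_measurable (G \<tau>)"
  by (rule var_events_measurable[OF Z_measurable]) (auto simp: sets_G intro!: sigma_sets.Basic)

text \<open>Labels have absolute value 1, so the absolute value of \<open>Z\<close> recovers the
  query indicator.\<close>

lemma Q_G:
  assumes "i \<in> {1..n}" "s \<in> {1..\<tau>}"
  shows "Q i s \<in> borel_measurable (G \<tau>)"
proof -
  have "Q i s \<omega> = \<bar>Z i s \<omega>\<bar>" if "\<omega> \<in> space (G \<tau>)" for \<omega>
    using that y_range[OF assms(1), of \<omega>] Q_range[OF assms(1), of s \<omega>] Z_eq[OF assms(1), of s \<omega>] assms(2)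
    by (auto simp: space_G)
  moreover have "(\<lambda>\<omega>. \<bar>Z i s \<omega>\<bar>) \<in> borel_measurable (G \<tau>)"
    using Z_G[OF assms] by measurable
  ultimately show ?thesis by (simp cong: measurable_cong)
qed

text \<open>The range extends to \<open>Suc \<tau>\<close> because the probabilities of a round are
  fixed before its draw. This allows them to be pulled out of the conditional expectation in
  \<open>round_loss_cond_exp\<close>.\<close>

lemma p_G:
  assumes "i \<in> {1..n}" "1 \<le> s" "s \<le> Suc \<tau>"
  shows "p i s \<in> borel_measurable (G \<tau>)"
proof (rule measurable_from_subalg[OF G_mono measurable_from_subalg[OF G_history p_predictable]])
  show "s - 1 \<le> \<tau>" using assms by simp
qed (use assms in auto)

lemma loss_G:
  assumes "h \<in> H" "i \<in> {1..n}"
  shows "loss h i \<in> borel_measurable (G \<tau>)"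
proof -
  have "(\<lambda>\<omega>. (x i \<omega>, y i \<omega>)) \<in> G \<tau> \<rightarrow>\<^sub>M example_space X"
    unfolding example_space_def using x_G[OF assms(2)] y_G[OF assms(2)] by measurable
  from measurable_compose[OF this loss_example_measurable[OF assms(1)]]
  show ?thesis by (simp add: loss_def[abs_def])
qed

lemmas loss_M = measurable_from_subalg[OF G_subalgebra loss_G]

lemma loss_nonneg: "0 \<le> loss h i \<omega>"
  by (simp add: loss_def L_nonneg)

lemma total_loss_nonneg: "0 \<le> total_loss h \<omega>"
  by (simp add: total_loss_def sum_nonneg loss_nonneg)

lemma p_pos: "i \<in> {1..n} \<Longrightarrow> 1 \<le> t \<Longrightarrow> \<omega> \<in> space M \<Longrightarrow> 0 < p i t \<omega>"
  using p_lower[of i t \<omega>] p_min_pos by linarith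

lemma loss_AE_bounded:
  assumes "h \<in> H"
  shows "AE \<omega> in M. \<forall>i\<in>{1..n}. loss h i \<omega> \<le> L_max"
  using L_bounded AE_space
proof eventually_elim
  case (elim \<omega>)
  show ?case
  proof
    fix i assume i: "i \<in> {1..n}"
    show "loss h i \<omega> \<le> L_max"
      unfolding loss_def using elim(1) i y_range[OF i elim(2)] assms by blast
  qed
qed

lemma loss_integrable:
  assumes "h \<in> H" "i \<in> {1..n}"
  shows "integrable M (loss h i)"
proof (rule integrable_const_bound[OF _ loss_M[OF assms]])
  show "AE \<omega> in M. norm (loss h i \<omega>) \<le> L_max"
    using loss_AE_bounded[OF assms(1)] by eventually_elim (use assms(2) loss_nonneg in auto)
qed

lemma L_max_nonneg:
  assumes "h \<in> H"
  shows "0 \<le> L_max"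
proof -
  have "AE \<omega> in M. 0 \<le> L_max"
    using loss_AE_bounded[OF assms]
    by eventually_elim (use n_pos in \<open>auto intro: order_trans[OF loss_nonneg]\<close>)
  then show ?thesis by simp
qed

section \<open>The importance weighted loss of one round\<close>

text \<open>Indicators with values 0 and 1 that sum to 1 select one index, so every weighted sum
  collapses to the value there.\<close>

lemma single_query:
  assumes "1 \<le> \<tau>" "\<omega> \<in> space M"
  obtains k where "k \<in> {1..n}"
    and "\<And>f. (\<Sum>i=1..n. Q i \<tau> \<omega> * f i) = (f k :: real)"
proof -
  have "\<exists>k\<in>{1..n}. Q k \<tau> \<omega> \<noteq> 0"
    using Q_sum[OF assms] by (metis sum.neutral zero_neq_one)
  then obtain k where k: "k \<in> {1..n}" "Q k \<tau> \<omega> = 1"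
    using Q_range assms by blast
  have "(\<Sum>i\<in>{1..n} - {k}. Q i \<tau> \<omega>) = 0"
    using Q_sum[OF assms] k by (simp add: sum.remove[of _ k])
  then have "Q i \<tau> \<omega> = 0" if "i \<in> {1..n} - {k}" for i
    using that Q_range[OF _ assms] by (subst (asm) sum_nonneg_eq_0_iff) force+
  then have "(\<Sum>i=1..n. Q i \<tau> \<omega> * f i) = f k" for f :: "nat \<Rightarrow> real"
    using k by (simp add: sum.remove[of _ k])
  with k(1) show ?thesis by (rule that)
qed

text \<open>Cross terms vanish because only one point is queried. This identifies the sum of squared
  round losses with the first double sum of \<open>emp_var\<close>.\<close>

lemma round_loss_square:
  assumes "1 \<le> \<tau>" "\<omega> \<in> space M"
  shows "(round_loss h \<tau> \<omega>)\<^sup>2 = (\<Sum>i=1..n. Q i \<tau> \<omega> / (p i \<tau> \<omega>)\<^sup>2 * (loss h i \<omega>)\<^sup>2)"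
proof -
  obtain k where k: "\<And>f. (\<Sum>i=1..n. Q i \<tau> \<omega> * f i) = (f k :: real)"
    using single_query[OF assms] by blast
  have "round_loss h \<tau> \<omega> = loss h k \<omega> / p k \<tau> \<omega>"
    using k[of "\<lambda>i. loss h i \<omega> / p i \<tau> \<omega>"] by (simp add: round_loss_def)
  moreover have "(\<Sum>i=1..n. Q i \<tau> \<omega> / (p i \<tau> \<omega>)\<^sup>2 * (loss h i \<omega>)\<^sup>2)
      = (loss h k \<omega>)\<^sup>2 / (p k \<tau> \<omega>)\<^sup>2"
    using k[of "\<lambda>i. (loss h i \<omega>)\<^sup>2 / (p i \<tau> \<omega>)\<^sup>2"] by (simp only: times_divide_eq_right times_divide_eq_left)
  ultimately show ?thesis by (simp add: power_divide)
qed

lemma round_loss_bounds: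
  assumes "1 \<le> \<tau>" "\<omega> \<in> space M" "\<forall>i\<in>{1..n}. loss h i \<omega> \<le> L_max"
  shows "0 \<le> round_loss h \<tau> \<omega>" and "round_loss h \<tau> \<omega> \<le> L_max / p_min"
proof -
  obtain k where k: "k \<in> {1..n}" "\<And>f. (\<Sum>i=1..n. Q i \<tau> \<omega> * f i) = (f k :: real)"
    using single_query[OF assms(1,2)] by blast
  have eq: "round_loss h \<tau> \<omega> = loss h k \<omega> / p k \<tau> \<omega>"
    using k(2)[of "\<lambda>i. loss h i \<omega> / p i \<tau> \<omega>"] by (simp add: round_loss_def)
  show "0 \<le> round_loss h \<tau> \<omega>"
    using eq loss_nonneg p_pos[OF k(1) assms(1,2)] by simp
  show "round_loss h \<tau> \<omega> \<le> L_max / p_min"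
    unfolding eq
    using bspec[OF assms(3) k(1)] loss_nonneg[of h k \<omega>] p_lower[OF k(1) assms(1,2)] p_min_pos
    by (intro frac_le) linarith+
qed

text \<open>Unlike \<open>round_loss_bounds\<close>, this does not presuppose the almost sure loss
  bound at \<omega>; the general tail bound asks for nonnegativity at every sample point.\<close>

lemma round_loss_nonneg: "1 \<le> \<tau> \<Longrightarrow> \<omega> \<in> space M \<Longrightarrow> 0 \<le> round_loss h \<tau> \<omega>"
  unfolding round_loss_def using Q_range
  by (intro sum_nonneg mult_nonneg_nonneg divide_nonneg_pos p_pos loss_nonneg) force+

lemma round_loss_G:
  assumes "h \<in> H" "1 \<le> \<tau>"
  shows "round_loss h \<tau> \<in> borel_measurable (G \<tau>)"
  unfolding round_loss_def[abs_def]
  using assms by (intro borel_measurable_sum borel_measurable_times borel_measurable_divide Q_G p_G loss_G) auto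

lemmas round_loss_M = measurable_from_subalg[OF G_subalgebra round_loss_G]

lemma total_loss_G: "h \<in> H \<Longrightarrow> total_loss h \<in> borel_measurable (G \<tau>)"
  unfolding total_loss_def[abs_def] by (intro borel_measurable_sum loss_G)

text \<open>The weights \<open>loss / p\<close> are known before the draw, and the conditional mean
  \<open>p\<close> of the indicator cancels their denominator.\<close>

lemma round_loss_cond_exp:
  assumes "h \<in> H"
  shows "AE \<omega> in M. real_cond_exp M (G \<tau>) (round_loss h (Suc \<tau>)) \<omega> = total_loss h \<omega>"
proof -
  interpret sub: finite_measure_subalgebra M "G \<tau>"
    by unfold_locales (rule G_subalgebra)
  define f where "f i \<omega> = loss h i \<omega> / p i (Suc \<tau>) \<omega>" for i \<omega>
  have f_G: "f i \<in> borel_measurable (G \<tau>)" if "i \<in> {1..n}" for i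
    unfolding f_def[abs_def] using that assms by (intro borel_measurable_divide loss_G p_G) auto
  have fQ_int: "integrable M (\<lambda>\<omega>. f i \<omega> * Q i (Suc \<tau>) \<omega>)" if i: "i \<in> {1..n}" for i
  proof (rule Bochner_Integration.integrable_bound[OF integrable_mult_right[OF loss_integrable[OF assms i], of "1 / p_min"]], goal_cases)
    case 1
    show ?case
      using measurable_from_subalg[OF G_subalgebra f_G[OF i]] Q_measurable[OF i, of "Suc \<tau>"] by measurable
  next
    case 2
    show ?case
    proof (rule AE_I2)
      fix \<omega> assume \<omega>: "\<omega> \<in> space M"
      have "loss h i \<omega> / p i (Suc \<tau>) \<omega> \<le> loss h i \<omega> / p_min"
        using p_lower[OF i _ \<omega>, of "Suc \<tau>"] p_min_pos loss_nonneg by (intro frac_le) auto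
      moreover have "0 \<le> loss h i \<omega> / p i (Suc \<tau>) \<omega>"
        using p_pos[OF i _ \<omega>, of "Suc \<tau>"] loss_nonneg by simp
      ultimately have "\<bar>loss h i \<omega> / p i (Suc \<tau>) \<omega>\<bar> \<le> \<bar>loss h i \<omega> / p_min\<bar>"
        by linarith
      then show "norm (f i \<omega> * Q i (Suc \<tau>) \<omega>) \<le> norm (1 / p_min * loss h i \<omega>)"
        using Q_range[OF i _ \<omega>, of "Suc \<tau>"] by (auto simp: f_def)
    qed
  qed
  have "AE \<omega> in M. real_cond_exp M (G \<tau>) (\<lambda>\<omega>. \<Sum>i\<in>{1..n}. f i \<omega> * Q i (Suc \<tau>) \<omega>) \<omega>
      = (\<Sum>i\<in>{1..n}. real_cond_exp M (G \<tau>) (\<lambda>\<omega>. f i \<omega> * Q i (Suc \<tau>) \<omega>) \<omega>)"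
  proof -
    \<comment> \<open>\<open>real_cond_exp_sum\<close> asks for integrability at every index, not
      just at those summed over; hence the extension by 0 outside the pool.\<close>
    define g where "g i \<omega> = (if i \<in> {1..n} then f i \<omega> * Q i (Suc \<tau>) \<omega> else 0)" for i \<omega>
    have "integrable M (g i)" for i
      using fQ_int[of i] by (cases "i \<in> {1..n}") (auto simp: g_def[abs_def])
    from sub.real_cond_exp_sum[where f = g and I = "{1..n}", OF this]
    have "AE \<omega> in M. real_cond_exp M (G \<tau>) (\<lambda>\<omega>. \<Sum>i\<in>{1..n}. g i \<omega>) \<omega>
        = (\<Sum>i\<in>{1..n}. real_cond_exp M (G \<tau>) (g i) \<omega>)" .
    moreover have "(\<Sum>i\<in>{1..n}. g i \<omega>) = (\<Sum>i\<in>{1..n}. f i \<omega> * Q i (Suc \<tau>) \<omega>)" for \<omega>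
      by (intro sum.cong) (auto simp: g_def)
    moreover have "(\<Sum>i\<in>{1..n}. real_cond_exp M (G \<tau>) (g i) \<omega>)
        = (\<Sum>i\<in>{1..n}. real_cond_exp M (G \<tau>) (\<lambda>\<omega>. f i \<omega> * Q i (Suc \<tau>) \<omega>) \<omega>)" for \<omega>
      by (intro sum.cong refl) (simp add: g_def[abs_def])
    ultimately show ?thesis by (simp only:)
  qed
  moreover have "AE \<omega> in M. \<forall>i\<in>{1..n}. real_cond_exp M (G \<tau>) (\<lambda>\<omega>. f i \<omega> * Q i (Suc \<tau>) \<omega>) \<omega> = loss h i \<omega>"
  proof (rule AE_finite_allI)
    fix i assume i: "i \<in> {1..n}"
    have "AE \<omega> in M. real_cond_exp M (G \<tau>) (\<lambda>\<omega>. f i \<omega> * Q i (Suc \<tau>) \<omega>) \<omega>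
        = f i \<omega> * real_cond_exp M (G \<tau>) (Q i (Suc \<tau>)) \<omega>"
      using i by (intro sub.real_cond_exp_mult f_G Q_measurable fQ_int) auto
    moreover have "AE \<omega> in M. real_cond_exp M (G \<tau>) (Q i (Suc \<tau>)) \<omega> = p i (Suc \<tau>) \<omega>"
      using draw[OF i, of "Suc \<tau>"] by simp
    ultimately show "AE \<omega> in M. real_cond_exp M (G \<tau>) (\<lambda>\<omega>. f i \<omega> * Q i (Suc \<tau>) \<omega>) \<omega> = loss h i \<omega>"
      using AE_space
    proof eventually_elim
      case (elim \<omega>)
      then show ?case using p_pos[OF i, of "Suc \<tau>" \<omega>] by (simp add: f_def)
    qed
  qed simp
  ultimately have "AE \<omega> in M. real_cond_exp M (G \<tau>) (\<lambda>\<omega>. \<Sum>i\<in>{1..n}. f i \<omega> * Q i (Suc \<tau>) \<omega>) \<omega> = total_loss h \<omega>"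
    by eventually_elim (simp add: total_loss_def)
  moreover have "round_loss h (Suc \<tau>) = (\<lambda>\<omega>. \<Sum>i\<in>{1..n}. f i \<omega> * Q i (Suc \<tau>) \<omega>)"
    by (simp add: round_loss_def[abs_def] f_def mult.commute)
  ultimately show ?thesis
    by (simp only:)
qed

lemma round_loss_integrable:
  assumes "h \<in> H" "1 \<le> \<tau>"
  shows "integrable M (round_loss h \<tau>)"
proof (rule integrable_const_bound[OF _ round_loss_M[OF assms]])
  show "AE \<omega> in M. norm (round_loss h \<tau> \<omega>) \<le> L_max / p_min"
    using loss_AE_bounded[OF assms(1)] AE_space
    by eventually_elim (use round_loss_bounds assms in auto)
qed

section \<open>Tail bounds for the pool loss and the observed losses\<close>

text \<open>The pool losses are independent with mean \<open>risk P L h\<close> and lie in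
  \<open>{0..L_max}\<close> almost surely. The deviation is chosen so that twice its square over
  \<open>n * L_max^2\<close>, the Hoeffding exponent, equals \<open>c\<close>.\<close>

lemma total_loss_tail:
  assumes "h \<in> H" "0 < c"
  shows "prob {\<omega>\<in>space M. real n * risk P L h + sqrt (L_max\<^sup>2 * c * real n / 2) < total_loss h \<omega>} \<le> exp (- c)"
proof (cases "L_max = 0")
  \<comment> \<open>Hoeffding's exponent would divide by 0 here. The event is null because its
    inequality is strict: the total loss is almost surely 0 and the risk is nonnegative.\<close>
  case True
  have "AE \<omega> in M. \<not> real n * risk P L h + sqrt (L_max\<^sup>2 * c * real n / 2) < total_loss h \<omega>"
    using loss_AE_bounded[OF assms(1)]
  proof eventually_elim
    case (elim \<omega>)
    then have "total_loss h \<omega> \<le> 0"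
      unfolding total_loss_def True by (intro sum_nonpos) auto
    moreover have "0 \<le> real n * risk P L h"
      by (simp add: risk_def L_nonneg)
    ultimately show ?case by (simp add: True)
  qed
  then show ?thesis by (simp add: prob_eq_0_AE)
next
  case False
  have sq: "(sqrt (L_max\<^sup>2 * c * real n / 2))\<^sup>2 = L_max\<^sup>2 * c * real n / 2"
    using assms by simp
  have ind: "indep_vars (\<lambda>_. borel) (loss h) {1..n}"
    using indep_vars_compose2[OF sample_indep, of "\<lambda>_ z. L (snd z * h (fst z))" "\<lambda>_. borel"]
      loss_example_measurable[OF assms(1)]
    by (simp add: loss_def[abs_def])
  interpret Hoeffding_ineq M "{1..n}" "loss h" "\<lambda>_. 0" "\<lambda>_. L_max" "\<Sum>i=1..n. expectation (loss h i)"
  proof unfold_locales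
    fix i assume "i \<in> {1..n}"
    then show "AE \<omega> in M. loss h i \<omega> \<in> {0..L_max}"
      using loss_AE_bounded[OF assms(1)] by (auto elim!: eventually_mono simp: loss_nonneg)
  qed (use ind in auto)
  have risk: "expectation (loss h i) = risk P L h" if i: "i \<in> {1..n}" for i
    unfolding risk_def sample_distr[OF i, symmetric]
    by (subst integral_distr[OF example_measurable[OF i] loss_example_measurable[OF assms(1)]])
      (simp add: loss_def[abs_def])
  have "prob {\<omega>\<in>space M. real n * risk P L h + sqrt (L_max\<^sup>2 * c * real n / 2) \<le> total_loss h \<omega>}
    \<le> exp (- 2 * (sqrt (L_max\<^sup>2 * c * real n / 2))\<^sup>2 / (\<Sum>i=1..n. (L_max - 0)\<^sup>2))"
    using Hoeffding_ineq_ge[of "sqrt (L_max\<^sup>2 * c * real n / 2)"] False n_pos assms risk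
    by (simp add: total_loss_def)
  also have "\<dots> = exp (- c)"
    unfolding sq using False n_pos by simp
  finally have "prob {\<omega>\<in>space M. real n * risk P L h + sqrt (L_max\<^sup>2 * c * real n / 2) \<le> total_loss h \<omega>} \<le> exp (- c)" .
  moreover have "prob {\<omega>\<in>space M. real n * risk P L h + sqrt (L_max\<^sup>2 * c * real n / 2) < total_loss h \<omega>}
    \<le> prob {\<omega>\<in>space M. real n * risk P L h + sqrt (L_max\<^sup>2 * c * real n / 2) \<le> total_loss h \<omega>}"
    using measurable_from_subalg[OF G_subalgebra total_loss_G[OF assms(1)]]
    by (intro finite_measure_mono) auto
  ultimately show ?thesis by linarith
qed

lemma round_loss_tail:
  assumes "h \<in> H" "0 < \<theta>"
  shows "prob {\<omega>\<in>space M. c / \<theta> + \<theta> / 2 * (\<Sum>\<tau>=1..t. (round_loss h \<tau> \<omega>)\<^sup>2)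
    \<le> (\<Sum>\<tau>=1..t. round_loss h \<tau> \<omega> - total_loss h \<omega>)} \<le> exp (- c)"
  using assms
  by (intro self_normalized_tail[where G = G] G_subalgebra G_mono round_loss_G total_loss_G
      round_loss_nonneg total_loss_nonneg round_loss_integrable round_loss_cond_exp) auto

section \<open>From the tail events to the risk inequality\<close>

lemma emp_risk_eq:
  "emp_risk n x y L p Q t h \<omega> = (\<Sum>\<tau>=1..t. round_loss h \<tau> \<omega>) / (real n * real t)"
  unfolding emp_risk_def round_loss_def loss_def[symmetric] by (subst sum.swap) simp

lemma emp_var_eq:
  assumes "\<omega> \<in> space M"
  shows "emp_var n x y L L_max p_min p Q \<delta> t h \<omega> = max 0
    ((\<Sum>\<tau>=1..t. (round_loss h \<tau> \<omega>)\<^sup>2)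
      - (\<Sum>i\<in>{i\<in>{1..n}. x i \<omega> \<in> queried n x Q t \<omega>}. loss h i \<omega>)\<^sup>2
      + L_max\<^sup>2 * sqrt (2 * real t * ln (1 / \<delta>) * (real n - 1)) / sqrt p_min)"
proof -
  have "(\<Sum>i=1..n. \<Sum>\<tau>=1..t. Q i \<tau> \<omega> / (p i \<tau> \<omega>)\<^sup>2 * (loss h i \<omega>)\<^sup>2)
      = (\<Sum>\<tau>=1..t. (round_loss h \<tau> \<omega>)\<^sup>2)"
    by (subst sum.swap) (use assms in \<open>auto simp: round_loss_square intro!: sum.cong\<close>)
  then show ?thesis
    unfolding emp_var_def loss_def[symmetric] by simp
qed

text \<open>Outside the tail events this is a pointwise consequence of
  \<open>deviation_le_of_grid\<close>, with the round loss bound \<open>L_max / p_min\<close> as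
  \<open>B\<close>. The larger \<open>b = L_max * (n + 1 / p_min)\<close> is what yields the factor
  \<open>1 + 1 / (n * p_min)\<close> after division by \<open>n * t\<close>.\<close>

lemma deviation_bound:
  assumes "h \<in> H" "4 \<le> t" "0 < \<delta>" "\<delta> < 1 / exp 1" "\<omega> \<in> space M"
    and bounded: "\<forall>i\<in>{1..n}. loss h i \<omega> \<le> L_max"
  defines "\<theta> \<equiv> \<lambda>j. exp (- real j) / (2 * (L_max / p_min))"
  assumes grid: "\<And>j. L_max \<noteq> 0 \<Longrightarrow> j < nat \<lfloor>ln (real t - 1)\<rfloor> \<Longrightarrow>
      (\<Sum>\<tau>=1..t. round_loss h \<tau> \<omega> - total_loss h \<omega>)
        < ln (1 / \<delta>) / \<theta> j + \<theta> j / 2 * (\<Sum>\<tau>=1..t. (round_loss h \<tau> \<omega>)\<^sup>2)"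
  shows "(\<Sum>\<tau>=1..t. round_loss h \<tau> \<omega>) - real t * total_loss h \<omega>
    \<le> 2 * ln (1 / \<delta>) * (L_max * (real n + 1 / p_min))
      + 4 * sqrt (emp_var n x y L L_max p_min p Q \<delta> t h \<omega> * ln (1 / \<delta>))"
proof -
  define a where "a = (\<Sum>\<tau>=1..t. round_loss h \<tau> \<omega>)"
  define U where "U = (\<Sum>\<tau>=1..t. (round_loss h \<tau> \<omega>)\<^sup>2)"
  define S' where "S' = (\<Sum>i\<in>{i\<in>{1..n}. x i \<omega> \<in> queried n x Q t \<omega>}. loss h i \<omega>)"
  define V where "V = U - S'\<^sup>2 + L_max\<^sup>2 * sqrt (2 * real t * ln (1 / \<delta>) * (real n - 1)) / sqrt p_min"
  have var: "emp_var n x y L L_max p_min p Q \<delta> t h \<omega> = max 0 V"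
    unfolding V_def U_def S'_def by (rule emp_var_eq) fact
  have "ln (1 / \<delta>) \<ge> ln (exp 1)"
    using assms(3,4) by (subst ln_le_cancel_iff) (auto simp: field_simps)
  then have c: "1 \<le> ln (1 / \<delta>)" by simp
  have L_max: "0 \<le> L_max" by (rule L_max_nonneg) fact
  show ?thesis
  proof (cases "L_max = 0")
    case True
    have "round_loss h \<tau> \<omega> = 0" if "\<tau> \<in> {1..t}" for \<tau>
      using round_loss_bounds[of \<tau> \<omega> h] that bounded \<open>\<omega> \<in> space M\<close> True by force
    moreover have "0 \<le> real t * total_loss h \<omega>"
      using total_loss_nonneg by simp
    moreover have "0 \<le> 4 * sqrt (max 0 V * ln (1 / \<delta>))"
      using c by simp
    ultimately have "a - real t * total_loss h \<omega> \<le> 4 * sqrt (max 0 V * ln (1 / \<delta>))"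
      unfolding a_def by (simp only: sum.neutral[OF ballI])
    then show ?thesis
      unfolding var by (simp add: True a_def)
  next
    case False
    then have "0 < L_max" using L_max by simp
    have "a - real t * total_loss h \<omega>
      \<le> 2 * ln (1 / \<delta>) * (L_max * (real n + 1 / p_min)) + 4 * sqrt (max 0 V * ln (1 / \<delta>))"
    proof (rule deviation_le_of_grid[where B = "L_max / p_min" and U = U])
      show "0 < L_max / p_min" using \<open>0 < L_max\<close> p_min_pos by simp
      show "L_max / p_min \<le> L_max * (real n + 1 / p_min)"
        using \<open>0 < L_max\<close> by (simp add: field_simps)
      show "0 \<le> total_loss h \<omega>" by (rule total_loss_nonneg)
      show "a\<^sup>2 \<le> real t * U"
        using sum_squared_le_sum_of_squares[of "\<lambda>\<tau>. round_loss h \<tau> \<omega>" "{1..t}"]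
        by (simp add: a_def U_def mult.commute)
      show "0 \<le> U" by (simp add: U_def sum_nonneg)
      have "U \<le> (\<Sum>\<tau>=1..t. (L_max / p_min)\<^sup>2)"
        unfolding U_def using round_loss_bounds[OF _ \<open>\<omega> \<in> space M\<close> bounded]
        by (intro sum_mono power_mono) auto
      then show "U \<le> real t * (L_max / p_min)\<^sup>2" by simp
      \<comment> \<open>Subtracting only the losses at queried points, and adding a nonnegative
        correction, can only enlarge the variance term compared with \<open>U - S^2\<close>.\<close>
      have "S' \<le> total_loss h \<omega>"
        unfolding S'_def total_loss_def by (intro sum_mono2) (auto simp: loss_nonneg)
      moreover have "0 \<le> S'" by (simp add: S'_def sum_nonneg loss_nonneg)
      ultimately have "S'\<^sup>2 \<le> (total_loss h \<omega>)\<^sup>2" by (intro power_mono)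
      moreover have "0 \<le> L_max\<^sup>2 * sqrt (2 * real t * ln (1 / \<delta>) * (real n - 1)) / sqrt p_min"
        using c n_pos p_min_pos by simp
      ultimately show "U - (total_loss h \<omega>)\<^sup>2 \<le> V" by (simp add: V_def)
    qed (use grid False c \<open>4 \<le> t\<close> in \<open>simp_all add: \<theta>_def a_def U_def sum_subtractf\<close>)
    then show ?thesis by (simp add: var a_def)
  qed
qed

text \<open>Both bounds are added and divided by \<open>n * t\<close>. The positive part costs
  nothing because the risk is nonnegative.\<close>

lemma risk_bound:
  assumes "h \<in> H" "4 \<le> t"
    and hoeffding: "total_loss h \<omega> \<le> real n * risk P L h + sqrt (L_max\<^sup>2 * c * real n / 2)"
    and dev: "(\<Sum>\<tau>=1..t. round_loss h \<tau> \<omega>) - real t * total_loss h \<omega>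
      \<le> 2 * c * (L_max * (real n + 1 / p_min)) + 4 * s"
  shows "max 0 (emp_risk n x y L p Q t h \<omega> - 2 / real t * c * L_max * (1 + 1 / (real n * p_min))
      - 4 / (real n * real t) * s - sqrt (L_max\<^sup>2 * c / (2 * real n))) \<le> risk P L h"
proof -
  have nt: "0 < real n" "0 < real t" using n_pos assms by auto
  \<comment> \<open>A factor \<open>n^2\<close> is moved out of the root, so that division by
    \<open>n\<close> leaves the Hoeffding term of the theorem.\<close>
  have "sqrt (L_max\<^sup>2 * c * real n / 2) = sqrt ((real n)\<^sup>2 * (L_max\<^sup>2 * c / (2 * real n)))"
    using nt by (simp add: power2_eq_square)
  also have "\<dots> = real n * sqrt (L_max\<^sup>2 * c / (2 * real n))"
    using nt by (simp only: real_sqrt_mult real_sqrt_abs abs_of_pos)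
  finally have "real t * total_loss h \<omega>
      \<le> real t * (real n * risk P L h + real n * sqrt (L_max\<^sup>2 * c / (2 * real n)))"
    using hoeffding nt by (intro mult_left_mono) auto
  with dev have "(\<Sum>\<tau>=1..t. round_loss h \<tau> \<omega>)
      \<le> 2 * c * (L_max * (real n + 1 / p_min)) + 4 * s
        + real t * (real n * risk P L h + real n * sqrt (L_max\<^sup>2 * c / (2 * real n)))"
    by linarith
  then have "emp_risk n x y L p Q t h \<omega> \<le> (2 * c * (L_max * (real n + 1 / p_min)) + 4 * s
        + real t * (real n * risk P L h + real n * sqrt (L_max\<^sup>2 * c / (2 * real n)))) / (real n * real t)"
    unfolding emp_risk_eq using nt by (intro divide_right_mono) auto
  also have "\<dots> = 2 / real t * c * L_max * (1 + 1 / (real n * p_min)) + 4 / (real n * real t) * s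
      + risk P L h + sqrt (L_max\<^sup>2 * c / (2 * real n))"
    using nt p_min_pos by (simp add: add_divide_distrib distrib_left) (simp add: field_simps)
  finally show ?thesis
    by (simp add: risk_def L_nonneg)
qed

section \<open>Measurability of the empirical quantities\<close>

lemma emp_risk_measurable:
  assumes "h \<in> H"
  shows "emp_risk n x y L p Q t h \<in> borel_measurable M"
  unfolding emp_risk_eq[abs_def]
  by (intro borel_measurable_divide borel_measurable_sum round_loss_M assms borel_measurable_const) auto

text \<open>The index set of the subtracted sum depends on \<omega>, so that sum is rewritten over
  the whole pool with a measurable predicate selecting the summands.\<close>

lemma emp_var_measurable:
  assumes "h \<in> H"
  shows "emp_var n x y L L_max p_min p Q \<delta> t h \<in> borel_measurable M"
proof -
  have x_borel: "x i \<in> borel_measurable M" if "i \<in> {1..n}" for i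
    using x_measurable[OF that] by (simp add: point_space_def measurable_restrict_space2_iff)
  \<comment> \<open>Coincidence of two pool points is expressed by distance 0, a condition on a real
    random variable. Repeated points count as queried along with their copies, as in
    \<open>queried\<close>.\<close>
  define q where "q i \<omega> \<longleftrightarrow> (\<exists>k\<in>{1..n}. dist (x i \<omega>) (x k \<omega>) = 0 \<and> 0 < (\<Sum>\<tau>=1..t. Q k \<tau> \<omega>))" for i \<omega>
  have q: "Measurable.pred M (q i)" if i: "i \<in> {1..n}" for i
    unfolding q_def[abs_def]
  proof (rule pred_intros_finite(4))
    fix k assume k: "k \<in> {1..n}"
    have "(\<lambda>\<omega>. \<Sum>\<tau>=1..t. Q k \<tau> \<omega>) \<in> borel_measurable M"
      using k by (intro borel_measurable_sum Q_measurable) auto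
    then show "Measurable.pred M (\<lambda>\<omega>. dist (x i \<omega>) (x k \<omega>) = 0 \<and> 0 < (\<Sum>\<tau>=1..t. Q k \<tau> \<omega>))"
      using x_borel[OF i] x_borel[OF k] by measurable
  qed simp
  have "(\<lambda>\<omega>. \<Sum>i=1..n. if q i \<omega> then loss h i \<omega> else 0) \<in> borel_measurable M"
    using q loss_M[OF assms] by (intro borel_measurable_sum measurable_If) auto
  moreover have "(\<lambda>\<omega>. \<Sum>\<tau>=1..t. (round_loss h \<tau> \<omega>)\<^sup>2) \<in> borel_measurable M"
    using round_loss_M[OF assms] by (intro borel_measurable_sum borel_measurable_power) auto
  ultimately have "(\<lambda>\<omega>. max 0
    ((\<Sum>\<tau>=1..t. (round_loss h \<tau> \<omega>)\<^sup>2) - (\<Sum>i=1..n. if q i \<omega> then loss h i \<omega> else 0)\<^sup>2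
      + L_max\<^sup>2 * sqrt (2 * real t * ln (1 / \<delta>) * (real n - 1)) / sqrt p_min)) \<in> borel_measurable M"
    by measurable
  moreover have "(\<Sum>i\<in>{i\<in>{1..n}. x i \<omega> \<in> queried n x Q t \<omega>}. loss h i \<omega>)
      = (\<Sum>i=1..n. if q i \<omega> then loss h i \<omega> else 0)" for \<omega>
  proof -
    have "{i\<in>{1..n}. x i \<omega> \<in> queried n x Q t \<omega>} = {i\<in>{1..n}. q i \<omega>}"
      unfolding q_def queried_def by auto
    then show ?thesis
      by (simp only: sum.inter_filter[OF finite_atLeastAtMost])
  qed
  ultimately show ?thesis
    using emp_var_eq by (simp cong: measurable_cong)
qed

end

section \<open>Union bound over hypotheses, rounds and grid points\<close>

theorem theorem3:
  fixes M :: "'w measure"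
    and X :: "(real ^ 'd) set"
    and P :: "((real ^ 'd) \<times> real) measure"
    and n :: nat
    and x :: "nat \<Rightarrow> 'w \<Rightarrow> real ^ 'd"
    and y :: "nat \<Rightarrow> 'w \<Rightarrow> real"
    and H :: "(real ^ 'd \<Rightarrow> real) set"
    and L :: "real \<Rightarrow> real"
    and L_max p_min :: real
    and p Q Z :: "nat \<Rightarrow> nat \<Rightarrow> 'w \<Rightarrow> real"
    and T :: nat
    and \<delta> :: real
  assumes setting: "pool_active_learning M X P n x y H L L_max p_min p Q Z"
    and finite_H: "finite H"
    and T: "4 \<le> T"
    and \<delta>: "0 < \<delta>" "\<delta> < 1 / exp 1"
  shows "\<P>(\<omega> in M. \<forall>h\<in>H. \<forall>t\<in>{4..T}.
            risk P L h \<ge>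
              max 0
               (emp_risk n x y L p Q t h \<omega>
                - 2 / real t * ln (1 / \<delta>) * L_max * (1 + 1 / (real n * p_min))
                - 4 / (real n * real t)
                    * sqrt (emp_var n x y L L_max p_min p Q \<delta> t h \<omega> * ln (1 / \<delta>))
                - sqrt (L_max\<^sup>2 * ln (1 / \<delta>) / (2 * real n))))
         \<ge> 1 - real (card H) * \<delta> * (2 + real T * ln (real T / exp 1))"
    (is "?\<P> \<ge> _")
proof -
  interpret pool_active_learning M X P n x y H L L_max p_min p Q Z by fact
  define c where "c = ln (1 / \<delta>)"
  define m where "m t = nat \<lfloor>ln (real t - 1)\<rfloor>" for t :: nat
  define \<theta> where "\<theta> j = exp (- real j) / (2 * (L_max / p_min))" for j :: nat
  define good where "good = {\<omega>\<in>space M. \<forall>h\<in>H. \<forall>t\<in>{4..T}.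
    max 0 (emp_risk n x y L p Q t h \<omega> - 2 / real t * c * L_max * (1 + 1 / (real n * p_min))
      - 4 / (real n * real t) * sqrt (emp_var n x y L L_max p_min p Q \<delta> t h \<omega> * c)
      - sqrt (L_max\<^sup>2 * c / (2 * real n))) \<le> risk P L h}"
  define E where "E h = {\<omega>\<in>space M. real n * risk P L h + sqrt (L_max\<^sup>2 * c * real n / 2) < total_loss h \<omega>}" for h
  (* The conjunct L_max \<noteq> 0 is there because \<theta> j = 0 (division by zero) when L_max = 0. *)
  define D where "D h t j = {\<omega>\<in>space M. L_max \<noteq> 0 \<and> c / \<theta> j + \<theta> j / 2 * (\<Sum>\<tau>=1..t. (round_loss h \<tau> \<omega>)\<^sup>2)
    \<le> (\<Sum>\<tau>=1..t. round_loss h \<tau> \<omega> - total_loss h \<omega>)}" for h t j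
  \<comment> \<open>One Hoeffding event per hypothesis serves all rounds, since it concerns only the
    fixed pool; the grid events are needed for every \<open>t\<close> separately.\<close>
  define B where "B = (\<Union>h\<in>H. E h \<union> (\<Union>t\<in>{4..T}. \<Union>j\<in>{..<m t}. D h t j))"
  have "ln (exp 1) < c"
    unfolding c_def using \<delta> by (subst ln_less_cancel_iff) (auto simp: field_simps)
  then have c: "0 < c" by simp
  have exp_c: "exp (- c) = \<delta>"
    using \<delta> by (simp add: c_def ln_div)
  have total_M: "total_loss h \<in> borel_measurable M" if "h \<in> H" for h
    by (rule measurable_from_subalg[OF G_subalgebra total_loss_G[OF that]])
  have E_M: "E h \<in> events" if "h \<in> H" for h
    unfolding E_def using total_M[OF that] by measurable
  have D_M: "D h t j \<in> events" if "h \<in> H" for h t j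
  proof -
    have "(\<lambda>\<omega>. \<Sum>\<tau>=1..t. (round_loss h \<tau> \<omega>)\<^sup>2) \<in> borel_measurable M"
      and "(\<lambda>\<omega>. \<Sum>\<tau>=1..t. round_loss h \<tau> \<omega> - total_loss h \<omega>) \<in> borel_measurable M"
      using round_loss_M[OF that] total_M[OF that]
      by (auto intro!: borel_measurable_sum borel_measurable_power borel_measurable_diff)
    then show ?thesis
      unfolding D_def by measurable
  qed
  have good_M: "good \<in> events"
    unfolding good_def
  proof (intro sets.sets_Collect_finite_All finite_H finite_atLeastAtMost)
    fix h t assume h: "h \<in> H"
    show "{\<omega>\<in>space M. max 0 (emp_risk n x y L p Q t h \<omega> - 2 / real t * c * L_max * (1 + 1 / (real n * p_min))
      - 4 / (real n * real t) * sqrt (emp_var n x y L L_max p_min p Q \<delta> t h \<omega> * c)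
      - sqrt (L_max\<^sup>2 * c / (2 * real n))) \<le> risk P L h} \<in> events"
      using emp_risk_measurable[OF h] emp_var_measurable[OF h] by measurable
  qed
  have Dt_M: "(\<Union>j\<in>{..<m t}. D h t j) \<in> events" if "h \<in> H" for h t
    using D_M[OF that] by auto
  have DT_M: "(\<Union>t\<in>{4..T}. \<Union>j\<in>{..<m t}. D h t j) \<in> events" if "h \<in> H" for h
    using Dt_M[OF that] by auto
  have B_M: "B \<in> events"
    unfolding B_def by (intro sets.finite_UN sets.Un E_M D_M finite_H) auto
  have prob_D: "prob (D h t j) \<le> \<delta>" if "h \<in> H" for h t j
  proof (cases "L_max = 0")
    case True
    then show ?thesis using \<delta> by (simp add: D_def)
  next
    case False
    then have "0 < \<theta> j"
      using L_max_nonneg[OF that] p_min_pos by (simp add: \<theta>_def)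
    then show ?thesis
      using round_loss_tail[OF that, of "\<theta> j" c t] False by (simp add: D_def exp_c)
  qed
  \<comment> \<open>Every event costs at most \<delta>: one for Hoeffding and at most
    \<open>ln (t - 1)\<close> in round \<open>t\<close>, which \<open>sum_ln_le\<close> adds up to
    \<open>2 + T * ln (T / e)\<close>.\<close>
  have "prob (E h \<union> (\<Union>t\<in>{4..T}. \<Union>j\<in>{..<m t}. D h t j)) \<le> \<delta> * (2 + real T * ln (real T / exp 1))"
    if h: "h \<in> H" for h
  proof -
    have "prob (\<Union>j\<in>{..<m t}. D h t j) \<le> \<delta> * ln (real t - 1)" if t: "t \<in> {4..T}" for t
    proof -
      have "prob (\<Union>j\<in>{..<m t}. D h t j) \<le> (\<Sum>j<m t. prob (D h t j))"
        by (rule finite_measure_subadditive_finite) (use D_M[OF h] in auto)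
      also have "\<dots> \<le> (\<Sum>j<m t. \<delta>)"
        by (intro sum_mono prob_D h)
      also have "\<dots> = \<delta> * real (m t)" by simp
      also have "real (m t) \<le> ln (real t - 1)"
        using t by (simp add: m_def)
      finally show ?thesis using \<delta> by simp
    qed
    then have "(\<Sum>t=4..T. prob (\<Union>j\<in>{..<m t}. D h t j)) \<le> (\<Sum>t=4..T. \<delta> * ln (real t - 1))"
      by (rule sum_mono)
    moreover have "prob (\<Union>t\<in>{4..T}. \<Union>j\<in>{..<m t}. D h t j) \<le> (\<Sum>t=4..T. prob (\<Union>j\<in>{..<m t}. D h t j))"
      by (rule finite_measure_subadditive_finite) (use Dt_M[OF h] in auto)
    moreover have "(\<Sum>t=4..T. \<delta> * ln (real t - 1)) \<le> \<delta> * (1 + real T * ln (real T / exp 1))"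
      unfolding sum_distrib_left[symmetric] using sum_ln_le[OF T] \<delta> by (intro mult_left_mono) auto
    moreover have "prob (E h) \<le> \<delta>"
      using total_loss_tail[OF h c] by (simp add: E_def exp_c)
    moreover have "prob (E h \<union> (\<Union>t\<in>{4..T}. \<Union>j\<in>{..<m t}. D h t j))
        \<le> prob (E h) + prob (\<Union>t\<in>{4..T}. \<Union>j\<in>{..<m t}. D h t j)"
      by (intro measure_Un_le E_M DT_M h)
    ultimately show ?thesis by (simp add: algebra_simps)
  qed
  then have "(\<Sum>h\<in>H. prob (E h \<union> (\<Union>t\<in>{4..T}. \<Union>j\<in>{..<m t}. D h t j)))
      \<le> (\<Sum>h\<in>H. \<delta> * (2 + real T * ln (real T / exp 1)))"
    by (rule sum_mono)
  moreover have "prob B \<le> (\<Sum>h\<in>H. prob (E h \<union> (\<Union>t\<in>{4..T}. \<Union>j\<in>{..<m t}. D h t j)))"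
    unfolding B_def by (rule finite_measure_subadditive_finite) (use finite_H E_M DT_M in blast)+
  ultimately have "prob B \<le> real (card H) * \<delta> * (2 + real T * ln (real T / exp 1))"
    by (simp add: mult.assoc)
  \<comment> \<open>The inclusion holds only almost everywhere, because the loss bound is an almost
    sure one; finiteness of \<open>H\<close> gives it for all hypotheses at once.\<close>
  moreover have "prob (space M - B) \<le> prob good"
  proof (rule finite_measure_mono_AE[OF _ good_M])
    have "AE \<omega> in M. \<forall>h\<in>H. \<forall>i\<in>{1..n}. loss h i \<omega> \<le> L_max"
      by (rule AE_finite_allI[OF finite_H]) (rule loss_AE_bounded)
    then show "AE \<omega> in M. \<omega> \<in> space M - B \<longrightarrow> \<omega> \<in> good"
    proof eventually_elim
      case (elim \<omega>)
      show ?case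
      proof
        assume \<omega>: "\<omega> \<in> space M - B"
        have "max 0 (emp_risk n x y L p Q t h \<omega> - 2 / real t * c * L_max * (1 + 1 / (real n * p_min))
          - 4 / (real n * real t) * sqrt (emp_var n x y L L_max p_min p Q \<delta> t h \<omega> * c)
          - sqrt (L_max\<^sup>2 * c / (2 * real n))) \<le> risk P L h" if h: "h \<in> H" and t: "t \<in> {4..T}" for h t
        proof (rule risk_bound[OF h])
          show "4 \<le> t" using t by simp
          show "total_loss h \<omega> \<le> real n * risk P L h + sqrt (L_max\<^sup>2 * c * real n / 2)"
            using \<omega> h by (auto simp: B_def E_def not_less)
          have "(\<Sum>\<tau>=1..t. round_loss h \<tau> \<omega> - total_loss h \<omega>)
              < c / \<theta> j + \<theta> j / 2 * (\<Sum>\<tau>=1..t. (round_loss h \<tau> \<omega>)\<^sup>2)" if "L_max \<noteq> 0" "j < m t" for j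
          proof -
            have "\<omega> \<notin> D h t j" using \<omega> h t that by (auto simp: B_def)
            then show ?thesis using \<omega> \<open>L_max \<noteq> 0\<close> by (simp add: D_def not_le)
          qed
          then show "(\<Sum>\<tau>=1..t. round_loss h \<tau> \<omega>) - real t * total_loss h \<omega>
              \<le> 2 * c * (L_max * (real n + 1 / p_min))
                + 4 * sqrt (emp_var n x y L L_max p_min p Q \<delta> t h \<omega> * c)"
            unfolding c_def \<theta>_def m_def using h t \<delta> \<omega> elim by (intro deviation_bound) auto
        qed
        then show "\<omega> \<in> good" using \<omega> by (simp add: good_def)
      qed
    qed
  qed
  moreover have "prob (space M - B) = 1 - prob B"
    by (rule prob_compl[OF B_M])
  moreover have "?\<P> = prob good"
    by (simp add: good_def c_def)
  ultimately show ?thesis by linarith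
qed

end
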